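(* For all positive integers $n,m$, the second player wins the Peaceable Knights Game $\mathrm{PN}(n,m)$ if and only if at least one of $n$ and $m$ is even.
   Context: The Peaceable Knights Game $\mathrm{PN}(n,m)$ is played on an $n\times m$ chessboard with squares $(x,y)$, $0\leq x\leq n-1$, $0\leq y\leq m-1$. Two players alternately place a knight on an unoccupied square; the first player places white knights and the second player places black knights. A player may not place a knight on a square within attacking range of a knight previously placed by the opponent. A player unable to move on their turn loses. Two squares $(x_1,y_1)$ and $(x_2,y_2)$ are within attacking range for knights iff either $x_2=x_1\pm1$ and $y_2=y_1\pm2$, or $x_2=x_1\pm2$ and $y_2=y_1\pm1$ (signs independent). A player "wins" the game if that player has a winning strategy. *)

theory Defs
  imports Main
begin

type_synonym square = "int \<times> int"

definition board :: "nat \<Rightarrow> nat \<Rightarrow> square set" where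
  "board n m = {(x, y). 0 \<le> x \<and> x \<le> int n - 1 \<and> 0 \<le> y \<and> y \<le> int m - 1}"

fun knight_attacks :: "square \<Rightarrow> square \<Rightarrow> bool" where
  "knight_attacks (x1, y1) (x2, y2) \<longleftrightarrow>
     ((x2 = x1 + 1 \<or> x2 = x1 - 1) \<and> (y2 = y1 + 2 \<or> y2 = y1 - 2)) \<or>
     ((x2 = x1 + 2 \<or> x2 = x1 - 2) \<and> (y2 = y1 + 1 \<or> y2 = y1 - 1))"

datatype player = First | Second

text \<open>
  A history is the list of squares in the order in which they were occupied. The players
  alternate, so the move with (zero-based) index \<open>k\<close> belongs to \<open>turn k\<close>; this determines
  the colour of every knight on the board.
\<close>

definition turn :: "nat \<Rightarrow> player" where
  "turn k = (if even k then First else Second)"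

definition to_move :: "square list \<Rightarrow> player" where
  "to_move h = turn (length h)"

definition knights_of :: "player \<Rightarrow> square list \<Rightarrow> square set" where
  "knights_of p h = {h ! k |k. k < length h \<and> turn k = p}"

definition legal_move :: "nat \<Rightarrow> nat \<Rightarrow> square list \<Rightarrow> square \<Rightarrow> bool" where
  "legal_move n m h s \<longleftrightarrow> s \<in> board n m \<and> s \<notin> set h \<and>
     (\<forall>q. q \<noteq> to_move h \<longrightarrow> (\<forall>t \<in> knights_of q h. \<not> knight_attacks t s))"

inductive play :: "nat \<Rightarrow> nat \<Rightarrow> square list \<Rightarrow> bool" for n m where
  start: "play n m []"
| move: "play n m h \<Longrightarrow> legal_move n m h s \<Longrightarrow> play n m (h @ [s])"

definition finished :: "nat \<Rightarrow> nat \<Rightarrow> square list \<Rightarrow> bool" where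
  "finished n m h \<longleftrightarrow> play n m h \<and> (\<nexists>s. legal_move n m h s)"

definition loser :: "square list \<Rightarrow> player" where
  "loser h = to_move h"

text \<open>
  A strategy for \<open>p\<close> must answer with a legal move at every history where \<open>p\<close> is to move and
  has a legal move at all; its values elsewhere are irrelevant.
\<close>

definition strategy :: "nat \<Rightarrow> nat \<Rightarrow> player \<Rightarrow> (square list \<Rightarrow> square) \<Rightarrow> bool" where
  "strategy n m p \<sigma> \<longleftrightarrow>
     (\<forall>h. play n m h \<and> to_move h = p \<and> (\<exists>s. legal_move n m h s) \<longrightarrow> legal_move n m h (\<sigma> h))"

definition follows :: "player \<Rightarrow> (square list \<Rightarrow> square) \<Rightarrow> square list \<Rightarrow> bool" where
  "follows p \<sigma> h \<longleftrightarrow> (\<forall>k < length h. turn k = p \<longrightarrow> h ! k = \<sigma> (take k h))"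

text \<open>
  No square is used twice, so a play has at most \<open>n * m\<close> moves. Hence there are no infinite
  plays, and it suffices to look at the finished ones.
\<close>

definition winning_strategy :: "nat \<Rightarrow> nat \<Rightarrow> player \<Rightarrow> (square list \<Rightarrow> square) \<Rightarrow> bool" where
  "winning_strategy n m p \<sigma> \<longleftrightarrow> strategy n m p \<sigma> \<and>
     (\<forall>h. finished n m h \<and> follows p \<sigma> h \<longrightarrow> loser h \<noteq> p)"

definition wins_PN :: "nat \<Rightarrow> nat \<Rightarrow> player \<Rightarrow> bool" where
  "wins_PN n m p \<longleftrightarrow> (\<exists>\<sigma>. winning_strategy n m p \<sigma>)"

end

(* With an even side, the second player answers by reflecting the last move across the axis that
   halves this side; with two odd sides, the first player opens in the centre and then answers by
   rotating the last move by 180 degrees. In both cases the symmetry phi preserves attacks, no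
   square attacks its image, and every fixed square is already occupied. The image of a fresh
   square s is then a legal answer: an opponent's knight t attacking phi s would make the
   answering player's knight phi t attack s. *)
theory Submission
  imports Defs
begin

lemma to_move_Nil: "to_move [] = First"
  by (simp add: to_move_def turn_def)

lemma to_move_snoc: "to_move (h @ [s]) = p \<longleftrightarrow> to_move h \<noteq> p"
  by (cases p) (auto simp: to_move_def turn_def)

lemma knights_of_Nil: "knights_of p [] = {}"
  by (simp add: knights_of_def)

lemma knights_of_snoc:
  "knights_of p (h @ [s]) = (if to_move h = p then insert s (knights_of p h) else knights_of p h)"
proof -
  have "{k. k < length (h @ [s]) \<and> turn k = p} =
      {k. k < length h \<and> turn k = p} \<union> (if to_move h = p then {length h} else {})"
    by (auto simp: to_move_def less_Suc_eq)
  moreover have "knights_of p g = (!) g ` {k. k < length g \<and> turn k = p}" for g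
    by (auto simp: knights_of_def)
  ultimately show ?thesis
    by (auto simp: image_Un nth_append)
qed

lemma follows_snoc:
  "follows p \<sigma> (h @ [s]) \<longleftrightarrow> follows p \<sigma> h \<and> (to_move h = p \<longrightarrow> s = \<sigma> h)"
  by (auto simp: follows_def to_move_def nth_append less_Suc_eq)

lemma play_distinct: "play n m h \<Longrightarrow> distinct h \<and> set h \<subseteq> board n m"
  by (induction rule: play.induct) (auto simp: legal_move_def)

lemma finite_board: "finite (board n m)"
proof -
  have "board n m = {0..int n - 1} \<times> {0..int m - 1}"
    by (auto simp: board_def)
  then show ?thesis
    by simp
qed

text \<open>If both players had winning strategies, let them play against each other: a longest play
  that follows both is finished, yet its loser can be neither player.\<close>

lemma not_both_win:
  assumes "wins_PN n m First"
  shows "\<not> wins_PN n m Second"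
proof
  assume "wins_PN n m Second"
  with assms obtain \<sigma> \<tau>
    where \<sigma>: "winning_strategy n m First \<sigma>" and \<tau>: "winning_strategy n m Second \<tau>"
    by (auto simp: wins_PN_def)
  define P where "P h \<longleftrightarrow> play n m h \<and> follows First \<sigma> h \<and> follows Second \<tau> h" for h
  have start: "P []"
    by (simp add: P_def follows_def play.start)
  \<comment> \<open>A play lists distinct squares of a finite board, so a longest one
    exists.\<close>
  have bound: "\<forall>h. P h \<longrightarrow> length h < Suc (card (board n m))"
    using play_distinct card_mono[OF finite_board] distinct_card by (metis P_def less_Suc_eq_le)
  from ex_has_greatest_nat[of P, OF start bound]
  obtain h where h: "P h" and max: "\<And>h'. P h' \<Longrightarrow> length h' \<le> length h"
    by blast
  have "\<not> legal_move n m h s" for s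
  proof
    assume s: "legal_move n m h s"
    define t where "t = (if to_move h = First then \<sigma> h else \<tau> h)"
    have "legal_move n m h t"
    proof (cases "to_move h")
      case First
      then show ?thesis
        using \<sigma> s h unfolding winning_strategy_def strategy_def P_def t_def
        by (metis player.distinct(1))
    next
      case Second
      then show ?thesis
        using \<tau> s h unfolding winning_strategy_def strategy_def P_def t_def
        by (metis player.distinct(1))
    qed
    then have "P (h @ [t])"
      using h by (auto simp: P_def follows_snoc t_def intro: play.move)
    from max[OF this] show False
      by simp
  qed
  then have "finished n m h"
    using h by (simp add: finished_def P_def)
  then have "loser h \<noteq> First" "loser h \<noteq> Second"
    using \<sigma> \<tau> h by (auto simp: winning_strategy_def P_def)
  then show False
    by (metis player.exhaust)
qed

text \<open>Reduces a win to an invariant \<open>I\<close> of the histories at which the opponent of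
  \<open>p\<close> is to move: whoever can always answer and restore \<open>I\<close> never gets
  stuck.\<close>

lemma wins_PN_by_invariant:
  assumes start: "if p = First then legal_move n m [] (\<sigma> []) \<and> I [\<sigma> []] else I []"
    and reply: "\<And>h s. \<lbrakk>to_move h \<noteq> p; I h; legal_move n m h s\<rbrakk> \<Longrightarrow>
      legal_move n m (h @ [s]) (\<sigma> (h @ [s])) \<and> I (h @ [s, \<sigma> (h @ [s])])"
  shows "wins_PN n m p"
proof -
  (* strategy demands a legal answer also at histories that break the invariant. *)
  define \<tau> where
    "\<tau> h = (if legal_move n m h (\<sigma> h) then \<sigma> h else SOME s. legal_move n m h s)" for h
  \<comment> \<open>At the turn of \<open>p\<close> the claim already looks one move ahead. Hence a
    move of \<open>p\<close> only carries out the promised answer, and a move of the opponent is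
    exactly \<open>reply\<close>.\<close>
  have inv: "if to_move h = p then legal_move n m h (\<sigma> h) \<and> I (h @ [\<sigma> h]) else I h"
    if "play n m h" "follows p \<tau> h" for h
    using that
  proof (induction rule: play.induct)
    case start
    then show ?case
      using assms(1) by (cases p) (auto simp: to_move_Nil)
  next
    case (move h s)
    then have IH: "if to_move h = p then legal_move n m h (\<sigma> h) \<and> I (h @ [\<sigma> h]) else I h"
      and s: "to_move h = p \<Longrightarrow> s = \<tau> h"
      by (auto simp: follows_snoc)
    show ?case
    proof (cases "to_move h = p")
      case True
      then show ?thesis
        using IH s by (simp add: to_move_snoc \<tau>_def)
    next
      case False
      then show ?thesis
        using IH reply[of h s] move.hyps by (simp add: to_move_snoc)
    qed
  qed
  have "strategy n m p \<tau>"
    by (auto simp: strategy_def \<tau>_def intro: someI)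
  moreover have "loser h \<noteq> p" if "finished n m h" "follows p \<tau> h" for h
    using that inv[of h] by (metis finished_def loser_def)
  ultimately show ?thesis
    by (auto simp: wins_PN_def winning_strategy_def)
qed

text \<open>A fixed square cannot be answered by its image. \<open>First\<close> may have one,
  \<open>c\<close>, and occupies it at once; \<open>Second\<close> must have none.\<close>

lemma wins_PN_by_symmetry:
  assumes board: "\<And>s. s \<in> board n m \<Longrightarrow> \<phi> s \<in> board n m"
    and involution: "\<And>s. \<phi> (\<phi> s) = s"
    and attacks: "\<And>s t. knight_attacks (\<phi> s) (\<phi> t) \<longleftrightarrow> knight_attacks s t"
    and no_attack: "\<And>s. \<not> knight_attacks s (\<phi> s)"
    and fixed: "{s \<in> board n m. \<phi> s = s} = (if p = First then {c} else {})"
  shows "wins_PN n m p"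
proof -
  define \<sigma> where "\<sigma> h = (if h = [] then c else \<phi> (last h))" for h
  \<comment> \<open>The last part is an inclusion, not an equality, because an opening knight of
    \<open>p\<close> on \<open>c\<close> is its own image.\<close>
  define I where "I h \<longleftrightarrow> {s \<in> board n m. \<phi> s = s} \<subseteq> set h \<and> \<phi> ` set h \<subseteq> set h \<and>
    (\<forall>q. q \<noteq> p \<longrightarrow> \<phi> ` knights_of q h \<subseteq> knights_of p h)" for h
  have knights_single: "knights_of q [s] = (if q = First then {s} else {})" for q s
    using knights_of_snoc[of q "[]" s] by (auto simp: to_move_Nil knights_of_Nil)
  show ?thesis
  proof (rule wins_PN_by_invariant[where \<sigma> = \<sigma> and I = I])
    show "if p = First then legal_move n m [] (\<sigma> []) \<and> I [\<sigma> []] else I []"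
    proof (cases "p = First")
      case True
      with fixed have "c \<in> board n m" "\<phi> c = c"
        by auto
      then show ?thesis
        using True fixed
        by (simp add: \<sigma>_def I_def legal_move_def knights_of_Nil knights_single)
    next
      case False
      then show ?thesis
        using fixed by (simp add: I_def knights_of_Nil)
    qed
  next
    fix h s
    assume turn: "to_move h \<noteq> p" and inv: "I h" and legal: "legal_move n m h s"
    have s: "s \<in> board n m" "s \<notin> set h"
      using legal by (auto simp: legal_move_def)
    have "\<phi> s \<noteq> s"
      using inv s by (auto simp: I_def)
    moreover have "\<phi> s \<notin> set h"
    proof
      assume "\<phi> s \<in> set h"
      then have "\<phi> (\<phi> s) \<in> set h"
        using inv by (auto simp: I_def)
      then show False
        using s by (simp add: involution)
    qed
    moreover have "\<not> knight_attacks t (\<phi> s)"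
      if q: "q \<noteq> p" and t: "t \<in> knights_of q (h @ [s])" for q t
    \<comment> \<open>The new knight \<open>s\<close> is the only one of the opponent whose image is
      not yet occupied, so it is handled by \<open>no_attack\<close> instead of the
      invariant.\<close>
    proof (cases "t = s")
      case True
      then show ?thesis
        by (simp add: no_attack)
    next
      case False
      then have "t \<in> knights_of q h"
        using t by (auto simp: knights_of_snoc split: if_splits)
      then have "\<phi> t \<in> knights_of p h"
        using inv q unfolding I_def by blast
      then have "\<not> knight_attacks (\<phi> t) s"
        using legal turn unfolding legal_move_def by metis
      then show ?thesis
        using attacks[of t "\<phi> s"] by (simp add: involution)
    qed
    moreover have p: "to_move (h @ [s]) = p"
      using turn by (simp add: to_move_snoc)
    ultimately have "legal_move n m (h @ [s]) (\<phi> s)"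
      using board[OF s(1)] unfolding legal_move_def by simp
    moreover have "I ((h @ [s]) @ [\<phi> s])"
      unfolding I_def knights_of_snoc p
      using inv turn by (simp add: I_def involution image_subset_iff subset_insertI2)
    ultimately show "legal_move n m (h @ [s]) (\<sigma> (h @ [s])) \<and> I (h @ [s, \<sigma> (h @ [s])])"
      by (simp add: \<sigma>_def)
  qed
qed

text \<open>A fixed square would need \<open>2 * x = int n - 1\<close>, which is odd. A square and
  its reflection share \<open>y\<close>, whereas a knight's move changes both coordinates.\<close>

lemma Second_wins_even_width:
  assumes "even n"
  shows "wins_PN n m Second"
proof (rule wins_PN_by_symmetry[where \<phi> = "\<lambda>(x, y). (int n - 1 - x, y)"])
  have "int n - 1 - x \<noteq> x" for x
    using assms by presburger
  \<comment> \<open>\<open>undefined\<close> is a placeholder for \<open>c\<close>; the right-hand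
    side is the empty set.\<close>
  then show "{s \<in> board n m. (case s of (x, y) \<Rightarrow> (int n - 1 - x, y)) = s} =
      (if Second = First then {undefined} else {})"
    by auto
qed (auto simp: board_def)

lemma Second_wins_even_height:
  assumes "even m"
  shows "wins_PN n m Second"
proof (rule wins_PN_by_symmetry[where \<phi> = "\<lambda>(x, y). (x, int m - 1 - y)"])
  have "int m - 1 - y \<noteq> y" for y
    using assms by presburger
  then show "{s \<in> board n m. (case s of (x, y) \<Rightarrow> (x, int m - 1 - y)) = s} =
      (if Second = First then {undefined} else {})"
    by auto
qed (auto simp: board_def)

lemma First_wins_odd:
  assumes "odd n" "odd m"
  shows "wins_PN n m First"
proof -
  obtain a b where ab: "n = 2 * a + 1" "m = 2 * b + 1"
    using assms by (auto elim!: oddE)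
  show ?thesis
  proof (rule wins_PN_by_symmetry[where \<phi> = "\<lambda>(x, y). (int n - 1 - x, int m - 1 - y)"])
    fix s :: square
    obtain x y where "s = (x, y)"
      by fastforce
    \<comment> \<open>Rotation about the centre changes each coordinate by an even amount, but a
      knight's move changes one of them by 1.\<close>
    moreover have "2 * int a - x \<noteq> x + 1" "2 * int a - x \<noteq> x - 1"
        "2 * int b - y \<noteq> y + 1" "2 * int b - y \<noteq> y - 1"
      by presburger+
    ultimately show "\<not> knight_attacks s (case s of (x, y) \<Rightarrow> (int n - 1 - x, int m - 1 - y))"
      by (simp add: ab)
  next
    show "{s \<in> board n m. (case s of (x, y) \<Rightarrow> (int n - 1 - x, int m - 1 - y)) = s} =
        (if First = First then {(int a, int b)} else {})"
      by (auto simp: board_def ab)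
  qed (auto simp: board_def)
qed

theorem theorem5p2:
  fixes n m :: nat
  assumes "n > 0" and "m > 0"
  shows "wins_PN n m Second \<longleftrightarrow> even n \<or> even m"
  \<comment> \<open>If both sides are odd, \<open>First\<close> wins, and
    \<open>not_both_win\<close> excludes a win of \<open>Second\<close>.\<close>
  using Second_wins_even_width Second_wins_even_height First_wins_odd not_both_win by metis

end
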